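(* Let $(\tilde{X},\tilde{d},E)$ be a soft metric space. Then $(\tilde{X},\tilde{d},E)$ is a soft sequentially compact metric space if and only if $(\tilde{X},\tilde{d},E)$ is soft complete and soft totally bounded.
   Context: $X$ is a set (the universe) and $E$ is a set of parameters. A soft set $(F,E)$ over $X$ is a map $F:E\to P(X)$. A soft point $\tilde{x}_e$ (also written $x_e$), with $x\in X$, $e\in E$, is the soft set $P$ with $P(e)=\{x\}$ and $P(e')=\varnothing$ for $e'\neq e$; two soft points $x_e,y_{e'}$ are equal iff $x=y$ and $e=e'$. One writes $x_e\in(F,E)$ if $x\in F(e)$; every soft set is the union of its soft points and is identified with the set of soft points belonging to it. $\tilde{X}$ is the absolute soft set ($F(e)=X$ for all $e\in E$), and $SP(\tilde X)$ is the set of all its soft points. A non-negative soft real number is a function $\tilde r:E\to[0,\infty)$; $\mathbb{R}(E)^*$ is the set of these. Order is pointwise: $\tilde r\le\tilde s$ (resp. $\tilde r<\tilde s$) means $\tilde r(e)\le\tilde s(e)$ (resp. $\tilde r(e)<\tilde s(e)$) for all $e\in E$; addition is pointwise; $\bar 0$ is the constant function $0$. A soft metric is a map $\tilde d:SP(\tilde X)\times SP(\tilde X)\to\mathbb{R}(E)^*$ such that, for all soft points, $\tilde d(x_{e_1},y_{e_2})\ge\bar 0$; $\tilde d(x_{e_1},y_{e_2})=\bar 0$ iff $x_{e_1}=y_{e_2}$; $\tilde d(x_{e_1},y_{e_2})=\tilde d(y_{e_2},x_{e_1})$; and $\tilde d(x_{e_1},z_{e_3})\le\tilde d(x_{e_1},y_{e_2})+\tilde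 d(y_{e_2},z_{e_3})$. Then $(\tilde X,\tilde d,E)$ is a soft metric space. For a soft real number $\tilde\varepsilon>\bar 0$, the soft open ball is $B(x_e,\tilde\varepsilon)=\{y_{e'}\in\tilde X:\tilde d(x_e,y_{e'})<\tilde\varepsilon\}$. A set $S$ of soft points is a soft $\tilde\varepsilon$-net if $\tilde X\subset\bigcup_{x_e\in S}B(x_e,\tilde\varepsilon)$. The space is (soft) totally bounded if for each soft real number $\tilde\varepsilon>\bar 0$ it has a finite soft $\tilde\varepsilon$-net. A soft sequence is a sequence $\{x^n_{e_n}\}_n$ of soft points of $\tilde X$ (the parameter may vary with $n$). It converges to a soft point $y_\mu$ if for every soft real number $\tilde\varepsilon>\bar 0$ there is $N\in\mathbb{N}$ with $\tilde d(x^n_{e_n},y_\mu)<\tilde\varepsilon$ for all $n>N$. It is Cauchy if for every soft real number $\tilde\varepsilon>\bar 0$ there is $m\in\mathbb{N}$ with $\tilde d(x^i_{e_i},x^j_{e_j})\le\tilde\varepsilon$ for all $i,j\ge m$. The space is (soft) complete if every Cauchy soft sequence converges to some soft point of $\tilde X$. The space is soft sequential(ly) compact if every soft sequence has a soft subsequence that converges in $\tilde X$. *)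

theory Defs
  imports Complex_Main "HOL-Library.FuncSet"
begin

text \<open>
  The universe \<open>X\<close> and the parameter set \<open>E\<close> are arbitrary carrier sets. A soft set over \<open>X\<close>
  with parameters \<open>E\<close>, i.e. a map from \<open>E\<close> to the subsets of \<open>X\<close>, is represented by a total
  function that takes the value \<open>{}\<close> outside \<open>E\<close>.
\<close>

type_synonym ('e, 'x) soft_set = "'e \<Rightarrow> 'x set"

definition soft_point :: "'x \<Rightarrow> 'e \<Rightarrow> ('e, 'x) soft_set" where
  "soft_point x e = (\<lambda>e'. if e' = e then {x} else {})"

definition soft_points_of :: "('e, 'x) soft_set \<Rightarrow> ('e, 'x) soft_set set" where
  "soft_points_of F = {soft_point x e | x e. x \<in> F e}"

definition absolute_soft_set :: "'x set \<Rightarrow> 'e set \<Rightarrow> ('e, 'x) soft_set" where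
  "absolute_soft_set X E = (\<lambda>e. if e \<in> E then X else {})"

definition SP :: "'x set \<Rightarrow> 'e set \<Rightarrow> ('e, 'x) soft_set set" where
  "SP X E = soft_points_of (absolute_soft_set X E)"

lemma soft_point_eq_iff: "soft_point x e = soft_point y e' \<longleftrightarrow> x = y \<and> e = e'"
  by (auto simp: soft_point_def fun_eq_iff split: if_splits)

lemma SP_eq: "SP X E = {soft_point x e | x e. x \<in> X \<and> e \<in> E}"
  by (auto simp: SP_def soft_points_of_def absolute_soft_set_def split: if_splits)

text \<open>
  Non-negative soft real numbers are extensional functions on \<open>E\<close>, so that equality of soft
  real numbers is equality on \<open>E\<close>.
\<close>

definition soft_nonneg_reals :: "'e set \<Rightarrow> ('e \<Rightarrow> real) set" where
  "soft_nonneg_reals E = E \<rightarrow>\<^sub>E {0..}"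

definition soft_le :: "'e set \<Rightarrow> ('e \<Rightarrow> real) \<Rightarrow> ('e \<Rightarrow> real) \<Rightarrow> bool" where
  "soft_le E r s \<longleftrightarrow> (\<forall>e\<in>E. r e \<le> s e)"

definition soft_less :: "'e set \<Rightarrow> ('e \<Rightarrow> real) \<Rightarrow> ('e \<Rightarrow> real) \<Rightarrow> bool" where
  "soft_less E r s \<longleftrightarrow> (\<forall>e\<in>E. r e < s e)"

definition soft_add :: "'e set \<Rightarrow> ('e \<Rightarrow> real) \<Rightarrow> ('e \<Rightarrow> real) \<Rightarrow> 'e \<Rightarrow> real" where
  "soft_add E r s = (\<lambda>e\<in>E. r e + s e)"

definition soft_zero :: "'e set \<Rightarrow> 'e \<Rightarrow> real" where
  "soft_zero E = (\<lambda>e\<in>E. 0)"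

definition soft_pos_reals :: "'e set \<Rightarrow> ('e \<Rightarrow> real) set" where
  "soft_pos_reals E = {\<epsilon> \<in> soft_nonneg_reals E. soft_less E (soft_zero E) \<epsilon>}"

type_synonym ('e, 'x) soft_dist = "('e, 'x) soft_set \<Rightarrow> ('e, 'x) soft_set \<Rightarrow> 'e \<Rightarrow> real"

locale soft_metric_space =
  fixes X :: "'x set" and E :: "'e set" and d :: "('e, 'x) soft_dist"
  assumes dist_closed: "d \<in> SP X E \<rightarrow> SP X E \<rightarrow> soft_nonneg_reals E"
    and dist_nonneg: "\<lbrakk>p \<in> SP X E; q \<in> SP X E\<rbrakk> \<Longrightarrow> soft_le E (soft_zero E) (d p q)"
    and dist_eq_zero_iff: "\<lbrakk>p \<in> SP X E; q \<in> SP X E\<rbrakk> \<Longrightarrow> d p q = soft_zero E \<longleftrightarrow> p = q"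
    and dist_sym: "\<lbrakk>p \<in> SP X E; q \<in> SP X E\<rbrakk> \<Longrightarrow> d p q = d q p"
    and dist_triangle:
      "\<lbrakk>p \<in> SP X E; q \<in> SP X E; r \<in> SP X E\<rbrakk> \<Longrightarrow> soft_le E (d p r) (soft_add E (d p q) (d q r))"

text \<open>Soft balls are identified with the sets of their soft points.\<close>

definition soft_ball ::
  "'x set \<Rightarrow> 'e set \<Rightarrow> ('e, 'x) soft_dist \<Rightarrow> ('e, 'x) soft_set \<Rightarrow> ('e \<Rightarrow> real) \<Rightarrow> ('e, 'x) soft_set set" where
  "soft_ball X E d p \<epsilon> = {q \<in> SP X E. soft_less E (d p q) \<epsilon>}"

definition soft_net ::
  "'x set \<Rightarrow> 'e set \<Rightarrow> ('e, 'x) soft_dist \<Rightarrow> ('e \<Rightarrow> real) \<Rightarrow> ('e, 'x) soft_set set \<Rightarrow> bool" where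
  "soft_net X E d \<epsilon> S \<longleftrightarrow> S \<subseteq> SP X E \<and> SP X E \<subseteq> (\<Union>p\<in>S. soft_ball X E d p \<epsilon>)"

definition soft_totally_bounded :: "'x set \<Rightarrow> 'e set \<Rightarrow> ('e, 'x) soft_dist \<Rightarrow> bool" where
  "soft_totally_bounded X E d \<longleftrightarrow>
     (\<forall>\<epsilon>\<in>soft_pos_reals E. \<exists>S. finite S \<and> soft_net X E d \<epsilon> S)"

definition soft_sequence :: "'x set \<Rightarrow> 'e set \<Rightarrow> (nat \<Rightarrow> ('e, 'x) soft_set) \<Rightarrow> bool" where
  "soft_sequence X E s \<longleftrightarrow> (\<forall>n. s n \<in> SP X E)"

definition soft_converges ::
  "'e set \<Rightarrow> ('e, 'x) soft_dist \<Rightarrow> (nat \<Rightarrow> ('e, 'x) soft_set) \<Rightarrow> ('e, 'x) soft_set \<Rightarrow> bool" where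
  "soft_converges E d s p \<longleftrightarrow>
     (\<forall>\<epsilon>\<in>soft_pos_reals E. \<exists>N. \<forall>n>N. soft_less E (d (s n) p) \<epsilon>)"

definition soft_Cauchy ::
  "'e set \<Rightarrow> ('e, 'x) soft_dist \<Rightarrow> (nat \<Rightarrow> ('e, 'x) soft_set) \<Rightarrow> bool" where
  "soft_Cauchy E d s \<longleftrightarrow>
     (\<forall>\<epsilon>\<in>soft_pos_reals E. \<exists>m. \<forall>i\<ge>m. \<forall>j\<ge>m. soft_le E (d (s i) (s j)) \<epsilon>)"

definition soft_complete :: "'x set \<Rightarrow> 'e set \<Rightarrow> ('e, 'x) soft_dist \<Rightarrow> bool" where
  "soft_complete X E d \<longleftrightarrow>
     (\<forall>s. soft_sequence X E s \<longrightarrow> soft_Cauchy E d s \<longrightarrow> (\<exists>p\<in>SP X E. soft_converges E d s p))"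

definition soft_sequentially_compact :: "'x set \<Rightarrow> 'e set \<Rightarrow> ('e, 'x) soft_dist \<Rightarrow> bool" where
  "soft_sequentially_compact X E d \<longleftrightarrow>
     (\<forall>s. soft_sequence X E s \<longrightarrow>
        (\<exists>k :: nat \<Rightarrow> nat. strict_mono k \<and> (\<exists>p\<in>SP X E. soft_converges E d (s \<circ> k) p)))"

end

theory Submission
  imports Defs "HOL-Library.Diagonal_Subsequence" "HOL-Library.Infinite_Set"
begin

text \<open>
  Each \<open>e \<in> E\<close> gives a pseudometric \<open>\<lambda>p q. d p q e\<close>, and a positive soft real chooses a radius for
  every one of them independently, as in a box topology. For infinite \<open>E\<close> the resulting uniformity
  has in general no countable base, so the textbook argument that extracts a Cauchy subsequence by
  diagonalising over a sequence of radii shrinking to zero does not apply directly.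

  What rescues the equivalence is that total boundedness in such a box uniformity is very strong:
  every sequence has a subsequence along which all but finitely many of the pseudometrics vanish
  identically (\<open>infinite_subset_dist_zero_cofinitely\<close>). Otherwise there are points \<open>a\<^sub>0, a\<^sub>1, \<dots>\<close>,
  pairwise distinct parameters \<open>e\<^sub>0, e\<^sub>1, \<dots>\<close> and reals \<open>\<delta>\<^sub>m > 0\<close> such that \<open>a\<^sub>m\<close> has distance at least
  \<open>\<delta>\<^sub>m\<close> in the parameter \<open>e\<^sub>m\<close> from all later \<open>a\<^sub>n\<close>; a soft real with value \<open>\<delta>\<^sub>m/2\<close> at each
  \<open>e\<^sub>m\<close> then has no finite net. Along such a subsequence only finitely many parameters matter, the
  constant radii \<open>1/(n+1)\<close> suffice, and the diagonal argument yields a Cauchy subsequence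
  (\<open>ex_Cauchy_subsequence\<close>), which converges by completeness.

  For the converse, the classical arguments work for one soft radius at a time: a Cauchy sequence
  with a convergent subsequence converges, and a radius without a finite net yields a sequence of
  points none of which lies in the ball about an earlier one, hence without convergent subsequence.
\<close>

section \<open>Soft metrics evaluated at a parameter\<close>

lemma restrict_mem_soft_pos_reals:
  assumes "\<And>e. e \<in> E \<Longrightarrow> 0 < f e"
  shows "restrict f E \<in> soft_pos_reals E"
  using assms
  by (auto simp: soft_pos_reals_def soft_nonneg_reals_def soft_less_def soft_zero_def less_imp_le)

lemma soft_pos_realsD: "\<epsilon> \<in> soft_pos_reals E \<Longrightarrow> e \<in> E \<Longrightarrow> 0 < \<epsilon> e"
  by (auto simp: soft_pos_reals_def soft_less_def soft_zero_def)

lemma half_mem_soft_pos_reals: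
  assumes "\<epsilon> \<in> soft_pos_reals E"
  shows "(\<lambda>e\<in>E. \<epsilon> e / 2) \<in> soft_pos_reals E"
  using assms by (intro restrict_mem_soft_pos_reals) (auto dest: soft_pos_realsD)

context soft_metric_space
begin

lemma dist_commute_at: "p \<in> SP X E \<Longrightarrow> q \<in> SP X E \<Longrightarrow> d p q e = d q p e"
  by (simp add: dist_sym)

lemma dist_nonneg_at: "p \<in> SP X E \<Longrightarrow> q \<in> SP X E \<Longrightarrow> e \<in> E \<Longrightarrow> 0 \<le> d p q e"
  using dist_nonneg[of p q] by (auto simp: soft_le_def soft_zero_def)

lemma dist_triangle_at:
  "p \<in> SP X E \<Longrightarrow> q \<in> SP X E \<Longrightarrow> r \<in> SP X E \<Longrightarrow> e \<in> E \<Longrightarrow> d p r e \<le> d p q e + d q r e"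
  using dist_triangle[of p q r] by (auto simp: soft_le_def soft_add_def)

section \<open>Sequential compactness implies completeness and total boundedness\<close>

lemma soft_sequentially_compact_imp_complete:
  assumes "soft_sequentially_compact X E d"
  shows "soft_complete X E d"
  unfolding soft_complete_def
proof (intro allI impI)
  fix s assume s: "soft_sequence X E s" and C: "soft_Cauchy E d s"
  have sn: "s n \<in> SP X E" for n using s by (simp add: soft_sequence_def)
  obtain k :: "nat \<Rightarrow> nat" and p where k: "strict_mono k" and p: "p \<in> SP X E"
    and conv: "soft_converges E d (s \<circ> k) p"
    using assms s unfolding soft_sequentially_compact_def by blast
  have "soft_converges E d s p"
    unfolding soft_converges_def
  proof
    fix \<epsilon> assume \<epsilon>: "\<epsilon> \<in> soft_pos_reals E"
    note half = half_mem_soft_pos_reals[OF \<epsilon>]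
    obtain m where m: "\<And>i j. i \<ge> m \<Longrightarrow> j \<ge> m \<Longrightarrow> soft_le E (d (s i) (s j)) (\<lambda>e\<in>E. \<epsilon> e / 2)"
      using C half unfolding soft_Cauchy_def by blast
    obtain N where N: "\<And>n. n > N \<Longrightarrow> soft_less E (d (s (k n)) p) (\<lambda>e\<in>E. \<epsilon> e / 2)"
      using conv half unfolding soft_converges_def comp_def by blast
    define l where "l = Suc (max m N)"
    have "k l \<ge> m"
      using seq_suble[OF k, of l] by (simp add: l_def)
    have "soft_less E (d (s n) p) \<epsilon>" if "n > m" for n
      unfolding soft_less_def
    proof
      fix e assume e: "e \<in> E"
      have "d (s n) (s (k l)) e \<le> \<epsilon> e / 2"
        using m[of n "k l"] that \<open>k l \<ge> m\<close> e by (simp add: soft_le_def)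
      moreover have "d (s (k l)) p e < \<epsilon> e / 2"
        using N[of l] e by (simp add: soft_less_def l_def)
      ultimately show "d (s n) p e < \<epsilon> e"
        using dist_triangle_at[OF sn sn p e, of n "k l"] by linarith
    qed
    then show "\<exists>N. \<forall>n>N. soft_less E (d (s n) p) \<epsilon>" by blast
  qed
  with p show "\<exists>p\<in>SP X E. soft_converges E d s p" by blast
qed

lemma soft_sequentially_compact_imp_totally_bounded:
  assumes "soft_sequentially_compact X E d"
  shows "soft_totally_bounded X E d"
  unfolding soft_totally_bounded_def
proof (rule ballI, rule ccontr)
  fix \<epsilon> assume \<epsilon>: "\<epsilon> \<in> soft_pos_reals E"
    and no_net: "\<nexists>S. finite S \<and> soft_net X E d \<epsilon> S"
  \<comment> \<open>Each term is chosen outside the balls about all earlier terms, by course-of-values choice.\<close>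
  have "\<exists>s :: nat \<Rightarrow> ('e, 'x) soft_set. \<forall>n. s n \<in> SP X E \<and> (\<forall>m<n. s n \<notin> soft_ball X E d (s m) \<epsilon>)"
  proof (rule dependent_wf_choice[OF wf_less_than, where
        P = "\<lambda>s n q. q \<in> SP X E \<and> (\<forall>m<n. q \<notin> soft_ball X E d (s m) \<epsilon>)"])
    fix n and s :: "nat \<Rightarrow> ('e, 'x) soft_set"
    assume "\<And>m. (m, n) \<in> less_than \<Longrightarrow> s m \<in> SP X E \<and> (\<forall>l<m. s m \<notin> soft_ball X E d (s l) \<epsilon>)"
    then have "s ` {..<n} \<subseteq> SP X E" by auto
    moreover have "\<not> soft_net X E d \<epsilon> (s ` {..<n})"
      using no_net by blast
    ultimately show "\<exists>q. q \<in> SP X E \<and> (\<forall>m<n. q \<notin> soft_ball X E d (s m) \<epsilon>)"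
      unfolding soft_net_def by auto
  qed auto
  then obtain s :: "nat \<Rightarrow> ('e, 'x) soft_set" where s: "\<And>n. s n \<in> SP X E"
    and sep: "\<And>m n. m < n \<Longrightarrow> s n \<notin> soft_ball X E d (s m) \<epsilon>"
    by blast
  obtain k :: "nat \<Rightarrow> nat" and p where k: "strict_mono k" and p: "p \<in> SP X E"
    and conv: "soft_converges E d (s \<circ> k) p"
    using assms s unfolding soft_sequentially_compact_def soft_sequence_def by blast
  obtain N where N: "\<And>n. n > N \<Longrightarrow> soft_less E (d (s (k n)) p) (\<lambda>e\<in>E. \<epsilon> e / 2)"
    using conv half_mem_soft_pos_reals[OF \<epsilon>] unfolding soft_converges_def comp_def by blast
  define i j where "i = k (Suc N)" and "j = k (Suc (Suc N))"
  have "i < j"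
    using k by (simp add: i_def j_def strict_mono_less)
  have "soft_less E (d (s i) (s j)) \<epsilon>"
    unfolding soft_less_def
  proof
    fix e assume e: "e \<in> E"
    have "d (s i) p e < \<epsilon> e / 2" "d (s j) p e < \<epsilon> e / 2"
      using N[of "Suc N"] N[of "Suc (Suc N)"] e by (simp_all add: soft_less_def i_def j_def)
    then show "d (s i) (s j) e < \<epsilon> e"
      using dist_triangle_at[OF s p s e, of i j] dist_commute_at[OF s p, of j e] by linarith
  qed
  with sep[OF \<open>i < j\<close>] s show False
    by (simp add: soft_ball_def)
qed

section \<open>Cauchy subsequences in totally bounded spaces\<close>

text \<open>
  Infinitely many terms lie in the same ball of radius \<open>\<epsilon>/2\<close> of a finite net.
\<close>

lemma totally_bounded_infinite_close_subset:
  assumes tb: "soft_totally_bounded X E d" and s: "\<And>n :: nat. s n \<in> SP X E"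
    and \<epsilon>: "\<epsilon> \<in> soft_pos_reals E"
  obtains I where "infinite I" "\<And>i j e. i \<in> I \<Longrightarrow> j \<in> I \<Longrightarrow> e \<in> E \<Longrightarrow> d (s i) (s j) e < \<epsilon> e"
proof -
  let ?h = "\<lambda>e\<in>E. \<epsilon> e / 2"
  obtain S where "finite S" "soft_net X E d ?h S"
    using bspec[OF tb[unfolded soft_totally_bounded_def] half_mem_soft_pos_reals[OF \<epsilon>]] by blast
  then have S: "finite S" "S \<subseteq> SP X E" "SP X E \<subseteq> (\<Union>p\<in>S. soft_ball X E d p ?h)"
    by (simp_all add: soft_net_def)
  have "\<forall>n. \<exists>p\<in>S. s n \<in> soft_ball X E d p ?h" 
  proof
    fix n
    show "\<exists>p\<in>S. s n \<in> soft_ball X E d p ?h" using subsetD[OF S(3) s[of n]] by simp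
  qed
  then obtain c where c: "\<And>n. c n \<in> S" "\<And>n. s n \<in> soft_ball X E d (c n) ?h" by metis
  have "finite (range c)" using c(1) S(1) by (meson finite_subset image_subsetI)
  then obtain m where inf: "infinite {n. c n = c m}"
    using pigeonhole_infinite[of UNIV c] by auto
  show thesis
  proof (rule that[OF inf])
    fix i j e assume ij: "i \<in> {n. c n = c m}" "j \<in> {n. c n = c m}" and e: "e \<in> E"
    have p: "c m \<in> SP X E" using c(1) S(2) by blast
    have "d (c m) (s i) e < \<epsilon> e / 2" "d (c m) (s j) e < \<epsilon> e / 2"
      using c(2)[of i] c(2)[of j] ij e by (auto simp: soft_ball_def soft_less_def)
    then show "d (s i) (s j) e < \<epsilon> e"
      using dist_triangle_at[OF s p s e, of i j] dist_commute_at[OF s p, of i e] by linarith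
  qed
qed

text \<open>
  Two points at distance \<open>2\<delta>\<close> have disjoint open balls of radius \<open>\<delta>\<close>, so infinitely many terms
  avoid the ball about one of them. Iterating this choice, with a new parameter each time, yields
  the sequence that refutes total boundedness in \<open>infinite_subset_dist_zero_cofinitely\<close>.
\<close>

lemma infinite_subset_far_from_point:
  assumes s: "\<And>n :: nat. s n \<in> SP X E" and A: "infinite A" and ij: "i \<in> A" "j \<in> A"
    and e: "e \<in> E" and ne: "d (s i) (s j) e \<noteq> 0"
  obtains a B \<delta> where "a \<in> A" "B \<subseteq> A" "infinite B" "0 < \<delta>" "\<And>n. n \<in> B \<Longrightarrow> \<delta> \<le> d (s a) (s n) e"
proof -
  define \<delta> where "\<delta> = d (s i) (s j) e / 2"
  have \<delta>: "0 < \<delta>" using ne dist_nonneg_at[OF s s e, of i j] by (simp add: \<delta>_def)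
  define far where "far a = {n \<in> A. \<delta> \<le> d (s a) (s n) e}" for a
  have "A \<subseteq> far i \<union> far j"
  proof
    fix n assume "n \<in> A"
    with dist_triangle_at[OF s[of i] s[of n] s[of j] e] dist_commute_at[OF s[of n] s[of j], of e]
    show "n \<in> far i \<union> far j" by (auto simp: far_def \<delta>_def field_simps)
  qed
  then have "infinite (far i) \<or> infinite (far j)"
    using A by (meson finite_UnI finite_subset)
  then obtain a where "a \<in> A" "infinite (far a)" using ij by blast
  with \<delta> show thesis by (intro that[of a "far a" \<delta>]) (auto simp: far_def)
qed

text \<open>
  If every infinite set of indices showed a nonzero distance in infinitely many parameters, the
  previous lemma could be iterated forever with a fresh parameter at each step. A positive soft real
  may take unrelated values at the parameters so obtained, and choosing them to be the lower
  bounds \<open>\<delta>\<close> excludes infinitely many mutually close terms.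
\<close>

lemma infinite_subset_dist_zero_cofinitely:
  assumes tb: "soft_totally_bounded X E d" and s: "\<And>n :: nat. s n \<in> SP X E"
  shows "\<exists>I F. infinite I \<and> finite F \<and> (\<forall>i\<in>I. \<forall>j\<in>I. \<forall>e\<in>E - F. d (s i) (s j) e = 0)"
proof (rule ccontr)
  assume "\<not> ?thesis"
  then have bad: "\<exists>i\<in>I. \<exists>j\<in>I. \<exists>e\<in>E - F. d (s i) (s j) e \<noteq> 0" if "infinite I" "finite F" for I F
    using that by blast
  \<comment> \<open>Iterate on pairs of the surviving indices and the parameters used so far.\<close>
  define Q where "Q = (\<lambda>(A, F) (A', F'). A' \<subseteq> A \<and> (\<exists>a\<in>A. \<exists>e\<in>E - F. \<exists>\<delta>>0.
      F' = insert e F \<and> (\<forall>n\<in>A'. \<delta> \<le> d (s a) (s n) e)))"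
  have "\<exists>f :: nat \<Rightarrow> nat set \<times> 'e set. \<forall>n. (infinite (fst (f n)) \<and> finite (snd (f n))) \<and> Q (f n) (f (Suc n))"
  proof (rule dependent_nat_choice[where P = "\<lambda>_ x. infinite (fst x) \<and> finite (snd x)" and Q = "\<lambda>_. Q"])
    show "\<exists>x :: nat set \<times> 'e set. infinite (fst x) \<and> finite (snd x)"
      by (rule exI[of _ "(UNIV, {})"]) simp
  next
    fix x :: "nat set \<times> 'e set"
    assume x: "infinite (fst x) \<and> finite (snd x)"
    obtain A F where AF: "x = (A, F)" by (cases x)
    with x have A: "infinite A" and F: "finite F" by auto
    obtain i j e where ij: "i \<in> A" "j \<in> A" and e: "e \<in> E - F"
      and ne: "d (s i) (s j) e \<noteq> 0"
      using bad[OF A F] by blast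
    then have "e \<in> E" by simp
    obtain a B \<delta> where B: "a \<in> A" "B \<subseteq> A" "infinite B" "0 < \<delta>"
      "\<And>n. n \<in> B \<Longrightarrow> \<delta> \<le> d (s a) (s n) e"
      by (rule infinite_subset_far_from_point[where s = s, OF s A ij \<open>e \<in> E\<close> ne]) blast
    then have "\<exists>\<delta>>0. insert e F = insert e F \<and> (\<forall>n\<in>B. \<delta> \<le> d (s a) (s n) e)"
      by blast
    with B(1,2) e have "Q x (B, insert e F)"
      unfolding Q_def AF prod.case by blast
    with B F show "\<exists>y. (infinite (fst y) \<and> finite (snd y)) \<and> Q x y"
      by (intro exI[of _ "(B, insert e F)"]) simp
  qed
  then obtain f where f: "\<And>n. Q (f n) (f (Suc n))" by blast
  define A F where "A n = fst (f n)" and "F n = snd (f n)" for n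
  have Q: "A (Suc n) \<subseteq> A n \<and> (\<exists>a\<in>A n. \<exists>e\<in>E - F n. \<exists>\<delta>>0.
      F (Suc n) = insert e (F n) \<and> (\<forall>i\<in>A (Suc n). \<delta> \<le> d (s a) (s i) e))" for n
    using f[of n] unfolding Q_def A_def F_def case_prod_beta .
  have A_Suc: "A (Suc n) \<subseteq> A n" for n
    using Q by blast
  have "\<forall>n. \<exists>a e \<delta>. a \<in> A n \<and> e \<in> E - F n \<and> 0 < \<delta> \<and> F (Suc n) = insert e (F n) \<and>
      (\<forall>i\<in>A (Suc n). \<delta> \<le> d (s a) (s i) e)"
    using Q by meson
  then obtain a e \<delta> where step: "\<forall>n. a n \<in> A n \<and> e n \<in> E - F n \<and> 0 < \<delta> n \<and>
      F (Suc n) = insert (e n) (F n) \<and> (\<forall>i\<in>A (Suc n). \<delta> n \<le> d (s (a n)) (s i) (e n))"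
    unfolding choice_iff by blast
  have a: "\<And>n. a n \<in> A n" and e: "\<And>n. e n \<in> E - F n" and \<delta>: "\<And>n. 0 < \<delta> n"
    and F_Suc: "\<And>n. F (Suc n) = insert (e n) (F n)"
    and far: "\<And>n i. i \<in> A (Suc n) \<Longrightarrow> \<delta> n \<le> d (s (a n)) (s i) (e n)"
    using step by simp_all
  have A_mono: "A n \<subseteq> A m" if "m \<le> n" for m n
    using lift_Suc_antimono_le[of A, OF A_Suc that] .
  have F_mono: "F m \<subseteq> F n" if "m \<le> n" for m n
    using lift_Suc_mono_le[of F, OF _ that] F_Suc by blast
  have sep: "\<delta> m \<le> d (s (a m)) (s (a n)) (e m)" if "m < n" for m n
    using far a A_mono[of "Suc m" n] that by (meson Suc_leI subsetD)
  have "e m \<noteq> e n" if "m < n" for m n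
    using e[of n] F_Suc[of m] F_mono[of "Suc m" n] that by auto
  then have "inj e"
    by (auto intro!: linorder_injI)
  \<comment> \<open>At parameters that were never chosen any positive value works.\<close>
  define \<epsilon> where "\<epsilon> = (\<lambda>x\<in>E. if x \<in> range e then \<delta> (inv e x) else 1)"
  have "\<epsilon> \<in> soft_pos_reals E"
    unfolding \<epsilon>_def using \<delta> by (intro restrict_mem_soft_pos_reals) auto
  then obtain I where "infinite I"
    and I: "\<And>i j x. i \<in> I \<Longrightarrow> j \<in> I \<Longrightarrow> x \<in> E \<Longrightarrow> d (s (a i)) (s (a j)) x < \<epsilon> x"
    by (rule totally_bounded_infinite_close_subset[OF tb, of "\<lambda>n. s (a n)" \<epsilon>, OF s]) blast
  obtain m where "m \<in> I" using infinite_imp_nonempty[OF \<open>infinite I\<close>] by blast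
  obtain n where "n \<in> I" "m < n" using \<open>infinite I\<close> by (meson infinite_nat_iff_unbounded)
  have "\<epsilon> (e m) = \<delta> m"
    using e[of m] \<open>inj e\<close> by (simp add: \<epsilon>_def)
  with I[OF \<open>m \<in> I\<close> \<open>n \<in> I\<close>, of "e m"] sep[OF \<open>m < n\<close>] e[of m] show False
    by simp
qed

text \<open>
  Once only the finitely many parameters in \<open>F\<close> contribute to distances, a soft real is as good as
  its minimum over \<open>F\<close>. So the countably many constant radii \<open>1/(n+1)\<close> decide the Cauchy property,
  and a diagonal subsequence takes care of all of them.
\<close>

lemma ex_Cauchy_subsequence:
  assumes tb: "soft_totally_bounded X E d" and s: "\<And>n :: nat. s n \<in> SP X E"
  obtains k :: "nat \<Rightarrow> nat" where "strict_mono k" "soft_Cauchy E d (s \<circ> k)"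
proof -
  obtain I F where "infinite I" and F: "finite F"
    and zero: "\<And>i j e. i \<in> I \<Longrightarrow> j \<in> I \<Longrightarrow> e \<in> E - F \<Longrightarrow> d (s i) (s j) e = 0"
    using infinite_subset_dist_zero_cofinitely[where s = s, OF tb s] by blast
  define k0 where "k0 = enumerate I"
  have k0: "strict_mono k0" "\<And>n. k0 n \<in> I"
    using \<open>infinite I\<close> by (auto simp: k0_def strict_mono_enumerate enumerate_in_set)
  let ?close = "\<lambda>n (r :: nat \<Rightarrow> nat). \<forall>i j. \<forall>e\<in>E. d (s (k0 (r i))) (s (k0 (r j))) e < 1 / real (Suc n)"
  interpret subseqs ?close
  proof
    fix n and r :: "nat \<Rightarrow> nat"
    let ?\<epsilon> = "\<lambda>e\<in>E. 1 / real (Suc n)"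
    have "?\<epsilon> \<in> soft_pos_reals E" by (intro restrict_mem_soft_pos_reals) simp
    then obtain J where J: "infinite J"
      "\<And>i j e. i \<in> J \<Longrightarrow> j \<in> J \<Longrightarrow> e \<in> E \<Longrightarrow> d (s (k0 (r i))) (s (k0 (r j))) e < ?\<epsilon> e"
      by (rule totally_bounded_infinite_close_subset[OF tb, of "\<lambda>n. s (k0 (r n))" ?\<epsilon>, OF s]) blast
    have "?close n (r \<circ> enumerate J)"
      using J(2)[OF enumerate_in_set[OF J(1)] enumerate_in_set[OF J(1)]] by simp
    with strict_mono_enumerate[OF J(1)] show "\<exists>r' :: nat \<Rightarrow> nat. strict_mono r' \<and> ?close n (r \<circ> r')"
      by (intro exI[of _ "enumerate J"] conjI)
  qed
  have diag: "?close n (diagseq \<circ> (+) (Suc n))" for n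
    by (rule diagseq_holds) simp
  show thesis
  proof (rule that)
    show "strict_mono (k0 \<circ> diagseq)"
      using k0(1) subseq_diagseq by (rule strict_mono_o)
    show "soft_Cauchy E d (s \<circ> (k0 \<circ> diagseq))"
      unfolding soft_Cauchy_def
    proof
      fix \<epsilon> assume \<epsilon>: "\<epsilon> \<in> soft_pos_reals E"
      \<comment> \<open>The element 1 only keeps the minimum defined when no parameter of \<open>E\<close> lies in \<open>F\<close>.\<close>
      define \<eta> where "\<eta> = Min (insert 1 (\<epsilon> ` (F \<inter> E)))"
      have "0 < \<eta>" using F \<epsilon> by (auto simp: \<eta>_def dest: soft_pos_realsD)
      then obtain n where n: "1 / real (Suc n) < \<eta>"
        using nat_approx_posE by blast
      have "soft_le E (d (s (k0 (diagseq i))) (s (k0 (diagseq j)))) \<epsilon>"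
        if ij: "i \<ge> Suc n" "j \<ge> Suc n" for i j
        unfolding soft_le_def
      proof
        fix e assume e: "e \<in> E"
        show "d (s (k0 (diagseq i))) (s (k0 (diagseq j))) e \<le> \<epsilon> e"
        proof (cases "e \<in> F")
          case True
          have "d (s (k0 (diagseq i))) (s (k0 (diagseq j))) e < 1 / real (Suc n)"
            using diag[of n, rule_format, of e "i - Suc n" "j - Suc n"] e ij by simp
          also note n
          also have "\<eta> \<le> \<epsilon> e" using True e F by (auto simp: \<eta>_def)
          finally show ?thesis by simp
        next
          case False
          then show ?thesis using zero[OF k0(2) k0(2)] e soft_pos_realsD[OF \<epsilon> e] by simp
        qed
      qed
      then show "\<exists>m. \<forall>i\<ge>m. \<forall>j\<ge>m.
          soft_le E (d ((s \<circ> (k0 \<circ> diagseq)) i) ((s \<circ> (k0 \<circ> diagseq)) j)) \<epsilon>"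
        by auto
    qed
  qed
qed

end

section \<open>The characterisation of sequential compactness\<close>

theorem theorem3p9:
  fixes X :: "'x set" and E :: "'e set" and d :: "('e, 'x) soft_dist"
  assumes "soft_metric_space X E d"
  shows "soft_sequentially_compact X E d \<longleftrightarrow> soft_complete X E d \<and> soft_totally_bounded X E d"
proof
  interpret soft_metric_space X E d by fact
  assume "soft_sequentially_compact X E d"
  then show "soft_complete X E d \<and> soft_totally_bounded X E d"
    by (simp add: soft_sequentially_compact_imp_complete
        soft_sequentially_compact_imp_totally_bounded)
next
  interpret soft_metric_space X E d by fact
  assume *: "soft_complete X E d \<and> soft_totally_bounded X E d"
  show "soft_sequentially_compact X E d"
    unfolding soft_sequentially_compact_def
  proof (intro allI impI)
    fix s assume s: "soft_sequence X E s"
    then obtain k :: "nat \<Rightarrow> nat" where k: "strict_mono k" "soft_Cauchy E d (s \<circ> k)"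
      using ex_Cauchy_subsequence[of s] * unfolding soft_sequence_def by blast
    moreover have "soft_sequence X E (s \<circ> k)"
      using s by (simp add: soft_sequence_def)
    ultimately show "\<exists>k :: nat \<Rightarrow> nat. strict_mono k \<and> (\<exists>p\<in>SP X E. soft_converges E d (s \<circ> k) p)"
      using * unfolding soft_complete_def by blast
  qed
qed

end
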